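(* Let $n$ be a positive integer and let $r_1,\dots,r_n$ be positive integers. The $n$-dimensional grid graph $\prod_{i = 1}^{n} P_{r_{i}}$ has edge metric dimension at most $n$.
   Context: $P_r$ denotes the path on $r$ vertices. The grid graph $\prod_{i=1}^{n}P_{r_i}$ is the Cartesian product of paths: its vertices are the integer points $(x_1,\dots,x_n)$ with $0\le x_i\le r_i-1$ for all $i$, and two vertices are adjacent if and only if they agree in all but one coordinate and differ by exactly $1$ in that coordinate. For vertices $u,v$ of a graph $G$, $d(u,v)$ is their distance in $G$. For an edge $e=\{x,y\}$ and a vertex $v$, let $d(e,v)=\min(d(x,v),d(y,v))$. A set $S\subset V(G)$ is a resolving set for the edges of $G$ if no two distinct edges $e,f$ satisfy $d(e,s)=d(f,s)$ for all $s\in S$. The edge metric dimension $\operatorname{edim}(G)$ is the minimum size of a resolving set for the edges of $G$. *)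

theory Defs
  imports Main "HOL-Library.FuncSet" "HOL-Library.Extended_Nat"
begin

text \<open>
  A simple graph is given by a vertex set \<open>V\<close> and a set \<open>E\<close> of edges, each edge being the
  two-element set of its endpoints.
\<close>

text \<open>
  The \<open>k\<close>-th relational power of adjacency relates the endpoints of the walks with \<open>k\<close> edges.
  Vertices in different components have distance \<open>\<infinity>\<close>.
\<close>

definition graph_dist :: "'a set set \<Rightarrow> 'a \<Rightarrow> 'a \<Rightarrow> enat" where
  "graph_dist E u v = Inf {enat k | k. (u, v) \<in> {(x, y). {x, y} \<in> E} ^^ k}"

definition edge_dist :: "'a set set \<Rightarrow> 'a set \<Rightarrow> 'a \<Rightarrow> enat" where
  "edge_dist E e v = Min ((\<lambda>x. graph_dist E x v) ` e)"

definition edge_resolving :: "'a set \<Rightarrow> 'a set set \<Rightarrow> 'a set \<Rightarrow> bool" where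
  "edge_resolving V E S \<longleftrightarrow> S \<subseteq> V \<and>
     \<not> (\<exists>e\<in>E. \<exists>f\<in>E. e \<noteq> f \<and> (\<forall>s\<in>S. edge_dist E e s = edge_dist E f s))"

text \<open>
  Infima are taken in \<^typ>\<open>enat\<close>: every nonempty set attains its infimum, and the value is \<open>\<infinity>\<close> if
  there is no finite edge-resolving set, which cannot happen for a finite simple graph.
\<close>

definition edim :: "'a set \<Rightarrow> 'a set set \<Rightarrow> enat" where
  "edim V E = Inf {enat (card S) | S. finite S \<and> edge_resolving V E S}"

text \<open>
  A point \<open>(x\<^sub>1, \<dots>, x\<^sub>n)\<close> is an extensional function on \<open>{1..n}\<close> (\<open>undefined\<close> elsewhere), so that
  equality of vertices is equality of coordinates.
\<close>

definition grid_verts :: "nat \<Rightarrow> (nat \<Rightarrow> nat) \<Rightarrow> (nat \<Rightarrow> nat) set" where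
  "grid_verts n r = (\<Pi>\<^sub>E i\<in>{1..n}. {..<r i})"

definition grid_adj :: "nat \<Rightarrow> (nat \<Rightarrow> nat) \<Rightarrow> (nat \<Rightarrow> nat) \<Rightarrow> bool" where
  "grid_adj n x y \<longleftrightarrow>
     (\<exists>i\<in>{1..n}. (y i = x i + 1 \<or> x i = y i + 1) \<and> (\<forall>j\<in>{1..n} - {i}. x j = y j))"

definition grid_edges :: "nat \<Rightarrow> (nat \<Rightarrow> nat) \<Rightarrow> (nat \<Rightarrow> nat) set set" where
  "grid_edges n r =
     {{x, y} | x y. x \<in> grid_verts n r \<and> y \<in> grid_verts n r \<and> grid_adj n x y}"

end

theory Submission
  imports Defs
begin

text \<open>
  Distance in the grid is the taxicab distance. As landmarks serve the origin and, for each
  coordinate \<open>i\<close> except the last, the corner whose only possibly nonzero coordinate is the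
  \<open>i\<close>-th one, of maximal value \<open>r\<^sub>i - 1\<close>: at most \<open>n\<close> points.

  Write an edge as \<open>{x, x + e\<^sub>k}\<close>, where \<open>e\<^sub>k\<close> is the \<open>k\<close>-th unit vector. Its distance to the
  origin is \<open>x\<^sub>1 + \<dots> + x\<^sub>n\<close>, attained at the lower end \<open>x\<close>. Its distance to the \<open>i\<close>-th corner is
  attained at \<open>x\<close> if \<open>k \<noteq> i\<close> and at \<open>x + e\<^sub>k\<close> if \<open>k = i\<close>; in both cases it is
  \<open>(x\<^sub>1 + \<dots> + x\<^sub>n) + (r\<^sub>i - 1) - (2 x\<^sub>i + [k = i])\<close>. The two kinds of distances therefore determine
  the number \<open>2 x\<^sub>i + [k = i]\<close> for every \<open>i < n\<close>. Its parity tells whether the edge has direction \<open>i\<close>,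
  and its half is \<open>x\<^sub>i\<close>. The direction is \<open>n\<close> if it is none of the others, and the coordinate sum
  yields \<open>x\<^sub>n\<close>; so the edge is determined.
\<close>

section \<open>Distance in the grid is taxicab distance\<close>

text \<open>
  With truncated subtraction, at most one of the two summands is nonzero, and their sum is the
  absolute difference.
\<close>

definition taxicab :: "nat \<Rightarrow> (nat \<Rightarrow> nat) \<Rightarrow> (nat \<Rightarrow> nat) \<Rightarrow> nat" where
  "taxicab n x y = (\<Sum>i\<in>{1..n}. (x i - y i) + (y i - x i))"

lemma taxicab_self: "taxicab n x x = 0"
  by (simp add: taxicab_def)

lemma taxicab_triangle: "taxicab n x z \<le> taxicab n x y + taxicab n y z"
proof -
  have truncated: "a - c \<le> (a - b) + (b - c)" for a b c :: nat
    by arith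
  show ?thesis
    unfolding taxicab_def sum.distrib[symmetric]
  proof (rule sum_mono)
    fix i
    show "(x i - z i) + (z i - x i) \<le> (x i - y i) + (y i - x i) + ((y i - z i) + (z i - y i))"
      using add_mono[OF truncated[of "x i" "z i" "y i"] truncated[of "z i" "x i" "y i"]]
      by (simp only: ac_simps)
  qed
qed

lemma taxicab_adj:
  assumes "grid_adj n x y"
  shows "taxicab n x y = 1"
proof -
  obtain i where i: "i \<in> {1..n}" "y i = x i + 1 \<or> x i = y i + 1"
    and rest: "\<forall>j\<in>{1..n} - {i}. x j = y j"
    using assms by (auto simp: grid_adj_def)
  have "taxicab n x y = ((x i - y i) + (y i - x i)) +
      (\<Sum>j\<in>{1..n} - {i}. (x j - y j) + (y j - x j))"
    unfolding taxicab_def by (rule sum.remove) (use i in auto)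
  also have "(\<Sum>j\<in>{1..n} - {i}. (x j - y j) + (y j - x j)) = 0"
    using rest by simp
  finally show ?thesis using i by auto
qed

lemma grid_adj_sym: "grid_adj n x y \<Longrightarrow> grid_adj n y x"
  unfolding grid_adj_def by (erule bexE, rule bexI) auto

lemma grid_edge_iff:
  "{x, y} \<in> grid_edges n r \<longleftrightarrow>
     x \<in> grid_verts n r \<and> y \<in> grid_verts n r \<and> grid_adj n x y"
proof
  assume "{x, y} \<in> grid_edges n r"
  then obtain a b where "{x, y} = {a, b}" "a \<in> grid_verts n r" "b \<in> grid_verts n r" "grid_adj n a b"
    unfolding grid_edges_def by blast
  moreover from this(4) have "grid_adj n b a" by (rule grid_adj_sym)
  ultimately show "x \<in> grid_verts n r \<and> y \<in> grid_verts n r \<and> grid_adj n x y"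
    unfolding doubleton_eq_iff by blast
next
  assume "x \<in> grid_verts n r \<and> y \<in> grid_verts n r \<and> grid_adj n x y"
  then show "{x, y} \<in> grid_edges n r" unfolding grid_edges_def by blast
qed

lemma taxicab_le_walk_length:
  "(x, y) \<in> {(x, y). {x, y} \<in> grid_edges n r} ^^ k \<Longrightarrow> taxicab n x y \<le> k"
proof (induction k arbitrary: y)
  case 0
  then show ?case by (simp add: taxicab_self)
next
  case (Suc k)
  then obtain z where z: "(x, z) \<in> {(x, y). {x, y} \<in> grid_edges n r} ^^ k"
    and "{z, y} \<in> grid_edges n r"
    by (elim relpow_Suc_E) blast
  then have zy: "grid_adj n z y" unfolding grid_edge_iff by blast
  show ?case
    using Suc.IH[OF z] taxicab_adj[OF zy] taxicab_triangle[of n x y z] by linarith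
qed

text \<open>
  Moving one step towards \<open>y\<close> in a coordinate where \<open>x\<close> and \<open>y\<close> differ stays inside the box and
  shortens the taxicab distance by one.
\<close>

lemma walk_of_taxicab_length:
  assumes "x \<in> grid_verts n r" "y \<in> grid_verts n r"
  shows "(x, y) \<in> {(x, y). {x, y} \<in> grid_edges n r} ^^ taxicab n x y"
  using assms(1)
proof (induction "taxicab n x y" arbitrary: x)
  case 0
  have "x j = y j" if "j \<in> {1..n}" for j
    using 0(1) that by (auto simp: taxicab_def intro: le_antisym)
  then have "x = y"
    using 0(2) assms(2) unfolding grid_verts_def by (blast intro: PiE_ext)
  then show ?case by (simp add: taxicab_self)
next
  case (Suc d)
  have "taxicab n x y \<noteq> 0" using Suc(2) by simp
  then obtain i where i: "i \<in> {1..n}" "x i \<noteq> y i"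
    unfolding taxicab_def by (rule sum.not_neutral_contains_not_neutral) auto
  define z where "z = x(i := if x i < y i then x i + 1 else x i - 1)"
  have bound: "x i < r i" "y i < r i"
    using Suc.prems assms(2) i by (auto simp: grid_verts_def PiE_def Pi_def)
  have z: "z \<in> grid_verts n r"
    using Suc.prems i bound
    by (auto simp: z_def grid_verts_def PiE_iff extensional_def less_imp_diff_less)
  have adj: "grid_adj n x z"
    unfolding grid_adj_def using i by (intro bexI[of _ i]) (auto simp: z_def)
  have split: "taxicab n w y = ((w i - y i) + (y i - w i)) +
      (\<Sum>j\<in>{1..n} - {i}. (w j - y j) + (y j - w j))" for w
    unfolding taxicab_def by (rule sum.remove) (use i in auto)
  have "(\<Sum>j\<in>{1..n} - {i}. (z j - y j) + (y j - z j)) =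
      (\<Sum>j\<in>{1..n} - {i}. (x j - y j) + (y j - x j))"
    by (rule sum.cong) (auto simp: z_def)
  moreover have "(x i - y i) + (y i - x i) = Suc ((z i - y i) + (y i - z i))"
    using i by (auto simp: z_def)
  ultimately have "taxicab n x y = Suc (taxicab n z y)"
    using split[of x] split[of z] by simp
  then have d: "d = taxicab n z y" using Suc(2) by simp
  have "(x, y) \<in> {(x, y). {x, y} \<in> grid_edges n r} ^^ Suc d"
    using Suc(1)[OF d z] adj z Suc.prems unfolding d
    by (intro relpow_Suc_I2[of x z]) (simp_all add: grid_edge_iff)
  then show ?case using Suc(2) by simp
qed

lemma graph_dist_grid:
  assumes "x \<in> grid_verts n r" "y \<in> grid_verts n r"
  shows "graph_dist (grid_edges n r) x y = enat (taxicab n x y)"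
  unfolding graph_dist_def
proof (rule antisym)
  show "Inf {enat k |k. (x, y) \<in> {(x, y). {x, y} \<in> grid_edges n r} ^^ k} \<le> enat (taxicab n x y)"
    using walk_of_taxicab_length[OF assms] by (intro Inf_lower) blast
  show "enat (taxicab n x y) \<le> Inf {enat k |k. (x, y) \<in> {(x, y). {x, y} \<in> grid_edges n r} ^^ k}"
    by (rule Inf_greatest) (auto dest: taxicab_le_walk_length)
qed

lemma edge_dist_grid:
  assumes "x \<in> grid_verts n r" "y \<in> grid_verts n r" "v \<in> grid_verts n r"
  shows "edge_dist (grid_edges n r) {x, y} v = enat (min (taxicab n x v) (taxicab n y v))"
  using assms by (simp add: edge_dist_def graph_dist_grid)

section \<open>Distances from an edge to the landmarks\<close>

lemma grid_edge_unit_step: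
  assumes "e \<in> grid_edges n r"
  obtains x k where "k \<in> {1..n}" "x \<in> grid_verts n r" "x(k := x k + 1) \<in> grid_verts n r"
    "e = {x, x(k := x k + 1)}"
proof -
  have step: "b = a(k := a k + 1)"
    if "a \<in> grid_verts n r" "b \<in> grid_verts n r" "b k = a k + 1" "\<forall>j\<in>{1..n} - {k}. a j = b j"
    for a b k
  proof
    fix j
    show "b j = (a(k := a k + 1)) j"
      using that by (cases "j \<in> {1..n}") (auto simp: grid_verts_def PiE_def extensional_def)
  qed
  obtain a b where ab: "e = {a, b}" "a \<in> grid_verts n r" "b \<in> grid_verts n r" "grid_adj n a b"
    using assms by (auto simp: grid_edges_def)
  then obtain k where k: "k \<in> {1..n}" "b k = a k + 1 \<or> a k = b k + 1"
    and rest: "\<forall>j\<in>{1..n} - {k}. a j = b j"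
    by (auto simp: grid_adj_def)
  from k(2) show thesis
  proof
    assume "b k = a k + 1"
    then have "b = a(k := a k + 1)" using step[OF ab(2,3) _ rest] by blast
    then show thesis using that[of k a] ab k(1) by simp
  next
    assume "a k = b k + 1"
    moreover have "\<forall>j\<in>{1..n} - {k}. b j = a j" using rest by simp
    ultimately have "a = b(k := b k + 1)" using step[OF ab(3,2)] by blast
    then show thesis using that[of k b] ab k(1) by (simp add: insert_commute)
  qed
qed

text \<open>
  The index \<open>0\<close> is not a coordinate, so \<open>corner n r 0\<close> is the origin, and the landmarks are the
  corners with index below \<open>n\<close>.
\<close>

definition corner :: "nat \<Rightarrow> (nat \<Rightarrow> nat) \<Rightarrow> nat \<Rightarrow> nat \<Rightarrow> nat" where
  "corner n r i = (\<lambda>j\<in>{1..n}. if j = i then r i - 1 else 0)"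

lemma corner_in_grid:
  assumes "\<And>i. i \<in> {1..n} \<Longrightarrow> r i \<ge> 1"
  shows "corner n r i \<in> grid_verts n r"
  using assms by (force simp: corner_def grid_verts_def)

lemma taxicab_origin: "taxicab n x (corner n r 0) = (\<Sum>j\<in>{1..n}. x j)"
  unfolding taxicab_def corner_def by (rule sum.cong) auto

lemma taxicab_corner:
  assumes "x \<in> grid_verts n r" "i \<in> {1..n}"
  shows "taxicab n x (corner n r i) + 2 * x i = (\<Sum>j\<in>{1..n}. x j) + (r i - 1)"
proof -
  have "x i < r i"
    using assms by (auto simp: grid_verts_def PiE_def Pi_def)
  moreover have "taxicab n x (corner n r i) = (x i - (r i - 1)) + ((r i - 1) - x i) +
      (\<Sum>j\<in>{1..n} - {i}. x j)"
    using assms(2) unfolding taxicab_def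
    by (subst sum.remove[of _ i]) (auto simp: corner_def intro!: sum.cong)
  moreover have "(\<Sum>j\<in>{1..n}. x j) = x i + (\<Sum>j\<in>{1..n} - {i}. x j)"
    by (rule sum.remove) (use assms(2) in auto)
  ultimately show ?thesis by linarith
qed

lemma sum_unit_step:
  fixes x :: "nat \<Rightarrow> nat"
  assumes "k \<in> {1..n}"
  shows "(\<Sum>j\<in>{1..n}. (x(k := x k + 1)) j) = (\<Sum>j\<in>{1..n}. x j) + 1"
proof -
  have "(\<Sum>j\<in>{1..n}. (x(k := x k + 1)) j) = (x k + 1) + (\<Sum>j\<in>{1..n} - {k}. x j)"
    by (subst sum.remove[of _ k]) (use assms in \<open>auto intro!: sum.cong\<close>)
  also have "\<dots> = (\<Sum>j\<in>{1..n}. x j) + 1"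
    by (subst (2) sum.remove[of _ k]) (use assms in auto)
  finally show ?thesis .
qed

lemma edge_dist_origin:
  assumes "\<And>i. i \<in> {1..n} \<Longrightarrow> r i \<ge> 1"
    and "k \<in> {1..n}" "x \<in> grid_verts n r" "x(k := x k + 1) \<in> grid_verts n r"
  shows "edge_dist (grid_edges n r) {x, x(k := x k + 1)} (corner n r 0) = enat (\<Sum>j\<in>{1..n}. x j)"
  using edge_dist_grid[OF assms(3,4) corner_in_grid[of n r 0, OF assms(1)]]
  unfolding taxicab_origin sum_unit_step[OF assms(2)]
  by simp

text \<open>
  The upper end of the edge is the nearer one exactly if the edge runs in direction \<open>i\<close>. Then the
  coordinate sum grows by \<open>1\<close> and \<open>2 * x i\<close> by \<open>2\<close> compared with the lower end, which leaves the
  correction term \<open>1\<close>.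
\<close>

lemma edge_dist_corner:
  assumes "\<And>i. i \<in> {1..n} \<Longrightarrow> r i \<ge> 1"
    and "k \<in> {1..n}" "x \<in> grid_verts n r" "x(k := x k + 1) \<in> grid_verts n r"
    and "i \<in> {1..n}"
  obtains d where "edge_dist (grid_edges n r) {x, x(k := x k + 1)} (corner n r i) = enat d"
    "d + (2 * x i + of_bool (k = i)) = (\<Sum>j\<in>{1..n}. x j) + (r i - 1)"
proof -
  let ?y = "x(k := x k + 1)"
  let ?d = "min (taxicab n x (corner n r i)) (taxicab n ?y (corner n r i))"
  have x: "taxicab n x (corner n r i) + 2 * x i = (\<Sum>j\<in>{1..n}. x j) + (r i - 1)"
    by (rule taxicab_corner[OF assms(3,5)])
  have y: "taxicab n ?y (corner n r i) + 2 * ?y i = (\<Sum>j\<in>{1..n}. x j) + 1 + (r i - 1)"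
    using taxicab_corner[OF assms(4,5)] unfolding sum_unit_step[OF assms(2)] .
  have "?d + (2 * x i + of_bool (k = i)) = (\<Sum>j\<in>{1..n}. x j) + (r i - 1)"
  proof (cases "k = i")
    case True
    then have "?y i = x i + 1" by simp
    then show ?thesis using x y True by simp
  next
    case False
    then have "?y i = x i" by simp
    then show ?thesis using x y False by simp
  qed
  with edge_dist_grid[OF assms(3,4) corner_in_grid[of n r i, OF assms(1)]] show thesis
    by (intro that[of ?d])
qed

section \<open>The landmarks resolve the edges\<close>

lemma corners_edge_resolving:
  assumes "n \<ge> 1" and r: "\<And>i. i \<in> {1..n} \<Longrightarrow> r i \<ge> 1"
  shows "edge_resolving (grid_verts n r) (grid_edges n r) (corner n r ` {..<n})"
proof -
  have "e = f"
    if e: "e \<in> grid_edges n r" and f: "f \<in> grid_edges n r"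
      and eq: "\<And>i. i < n \<Longrightarrow>
        edge_dist (grid_edges n r) e (corner n r i) = edge_dist (grid_edges n r) f (corner n r i)"
    for e f
  proof -
    obtain x k where x: "k \<in> {1..n}" "x \<in> grid_verts n r" "x(k := x k + 1) \<in> grid_verts n r"
      and ex: "e = {x, x(k := x k + 1)}"
      using grid_edge_unit_step[OF e] .
    obtain y l where y: "l \<in> {1..n}" "y \<in> grid_verts n r" "y(l := y l + 1) \<in> grid_verts n r"
      and fy: "f = {y, y(l := y l + 1)}"
      using grid_edge_unit_step[OF f] .
    have sums: "(\<Sum>j\<in>{1..n}. x j) = (\<Sum>j\<in>{1..n}. y j)"
      using eq[of 0] assms(1) edge_dist_origin[of n r, OF r x] edge_dist_origin[of n r, OF r y]
      by (simp add: ex fy)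
    have coord: "x i = y i \<and> (k = i \<longleftrightarrow> l = i)" if i: "1 \<le> i" "i < n" for i
    proof -
      have i': "i \<in> {1..n}" using i by simp
      obtain d where d: "edge_dist (grid_edges n r) e (corner n r i) = enat d"
        "d + (2 * x i + of_bool (k = i)) = (\<Sum>j\<in>{1..n}. x j) + (r i - 1)"
        unfolding ex by (rule edge_dist_corner[of n r, OF r x i'])
      obtain d' where d': "edge_dist (grid_edges n r) f (corner n r i) = enat d'"
        "d' + (2 * y i + of_bool (l = i)) = (\<Sum>j\<in>{1..n}. y j) + (r i - 1)"
        unfolding fy by (rule edge_dist_corner[of n r, OF r y i'])
      have "d = d'" using eq[OF i(2)] d(1) d'(1) by simp
      then have *: "2 * x i + of_bool (k = i) = 2 * y i + of_bool (l = i)"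
        using d(2) d'(2) sums by linarith
      have "k = i \<longleftrightarrow> l = i"
        using arg_cong[OF *, of even] by (cases "k = i"; cases "l = i") simp_all
      with * show ?thesis by simp
    qed
    \<comment> \<open>A direction below \<open>n\<close> is seen by its own corner, direction \<open>n\<close> by none.\<close>
    have "k = l"
      using coord[of k] coord[of l] x(1) y(1) by (cases "k < n"; cases "l < n") auto
    have split_last: "(\<Sum>j\<in>{1..n}. w j) = w n + (\<Sum>j\<in>{1..n} - {n}. w j)" for w :: "nat \<Rightarrow> nat"
      by (rule sum.remove) (use assms(1) in auto)
    have "(\<Sum>j\<in>{1..n} - {n}. x j) = (\<Sum>j\<in>{1..n} - {n}. y j)"
      by (rule sum.cong) (use coord in auto)
    then have "x n = y n"
      using sums split_last[of x] split_last[of y] by simp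
    then have "x j = y j" if "j \<in> {1..n}" for j
      using coord[of j] that by (cases "j = n") auto
    then have "x = y"
      by (rule PiE_ext[OF x(2)[unfolded grid_verts_def] y(2)[unfolded grid_verts_def]])
    with \<open>k = l\<close> show "e = f" by (simp add: ex fy)
  qed
  moreover have "corner n r ` {..<n} \<subseteq> grid_verts n r"
    using corner_in_grid[of n r, OF r] by (rule image_subsetI)
  ultimately show ?thesis
    unfolding edge_resolving_def by (meson imageI lessThan_iff)
qed

text \<open>
  If \<open>r i\<close> is \<open>1\<close> for some \<open>0 < i < n\<close>, the corner \<open>i\<close> coincides with the origin, so
  the number of landmarks may be smaller than \<open>n\<close>; an upper bound on it suffices.
\<close>

theorem theorem4p1:
  fixes n :: nat and r :: "nat \<Rightarrow> nat"
  assumes "n \<ge> 1" and "\<And>i. i \<in> {1..n} \<Longrightarrow> r i \<ge> 1"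
  shows "edim (grid_verts n r) (grid_edges n r) \<le> enat n"
proof -
  let ?S = "corner n r ` {..<n}"
  have "edge_resolving (grid_verts n r) (grid_edges n r) ?S"
    by (rule corners_edge_resolving[of n r, OF assms])
  then have "edim (grid_verts n r) (grid_edges n r) \<le> enat (card ?S)"
    unfolding edim_def by (intro Inf_lower CollectI exI[of _ ?S] conjI) simp_all
  also have "\<dots> \<le> enat n"
    using card_image_le[of "{..<n}" "corner n r"] by simp
  finally show ?thesis .
qed

end
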